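(* Let $s\ge2$, $k\ge1$, $1\le r\le s$, and $n,p\ge0$ be integers. The number of words $\pi\in[sk]^n$ with $\overleftarrow{\mathrm{des}}_{R_r}(\pi)=p$, which also equals the number of words $\pi\in[sk]^n$ with $\overleftarrow{\mathrm{ris}}_{R_{s+1-r}}(\pi)=p$, is $$\sum_{j=0}^n\sum_{i_1=0}^j\sum_{i_2=0}^j(-1)^{n+p+i_2}s^{j-i_1}(r-1)^{i_1}\binom{j}{i_1}\binom{j}{i_2}\binom{ki_2}{n-i_1}\binom{n-j}{p}.$$
   Context: $[N]=\{1,\ldots,N\}$ and $[N]^n$ is the set of words of length $n$ over $[N]$. For an integer $c$, $R_c=\{x\in\mathbb{N}: x\equiv c \pmod s\}$. For a word $\pi=\pi_1\cdots\pi_n$ and $X\subseteq\mathbb{N}$, $\overleftarrow{\mathrm{des}}_X(\pi)=|\{i:\pi_i>\pi_{i+1},\ \pi_i\in X\}|$ and $\overleftarrow{\mathrm{ris}}_X(\pi)=|\{i:\pi_i<\pi_{i+1},\ \pi_i\in X\}|$. Conventions: $\binom{a}{b}=0$ if $b<0$ or $b>a$ (for $a\ge0$), and $0^0=1$. *)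

theory Defs
  imports Complex_Main "HOL-Number_Theory.Cong"
begin

definition words :: "nat \<Rightarrow> nat \<Rightarrow> nat list set" where
  "words N n = {w. length w = n \<and> set w \<subseteq> {1..N}}"

definition residue_class :: "nat \<Rightarrow> int \<Rightarrow> nat set" where
  "residue_class s c = {x. [int x = c] (mod int s)}"

text \<open>List positions are counted from 0; the pairs of adjacent letters of \<open>w\<close> are
  those at positions \<open>i\<close> and \<open>Suc i\<close> with \<open>Suc i < length w\<close>.\<close>

definition des_left :: "nat set \<Rightarrow> nat list \<Rightarrow> nat" where
  "des_left X w = card {i. Suc i < length w \<and> w ! i > w ! Suc i \<and> w ! i \<in> X}"

definition ris_left :: "nat set \<Rightarrow> nat list \<Rightarrow> nat" where
  "ris_left X w = card {i. Suc i < length w \<and> w ! i < w ! Suc i \<and> w ! i \<in> X}"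

end

theory Submission
  imports Defs "HOL-Computational_Algebra.Computational_Algebra"
begin

text \<open>
  Weight each word by $x^{\mathrm{des}}$ and put $y = x - 1$. Let $F(t)$ be the generating function
  of all words by length, and $G_a(t)$ the one in which the descents of $w$ preceded by the letter
  $a$ are counted. Since $x^{[a \in X,\, a > b]} = 1 + y\,[a \in X,\, a > b]$, we have
  $G_a = F + y t\,[a \in X] \sum_{b<a} G_b$, so the partial sums of $G$ are $F \cdot T_a(yt)$ with
  $T_{a}(z) = T_{a-1}(z)(1 + z[a \in X]) + 1$. For $X = R_r$ this recursion, run through
  blocks of $s$ letters, gives $z\,T_{sk}(z) = ((1+z)^k - 1)(s + (r-1)z)$. From
  $F = 1 + t F\,T_{sk}(yt)$ the series $F$ is geometric, and the formula follows
  by expanding each power binomially and extracting the coefficient of $x^p$ in $(x-1)^{n-j}$.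
\<close>

section \<open>Words and descents\<close>

lemma words_0 [simp]: "words N 0 = {[]}"
  by (auto simp: words_def)

lemma words_Suc: "words N (Suc n) = (\<lambda>(b, w). b # w) ` ({1..N} \<times> words N n)"
  by (auto simp: words_def length_Suc_conv image_iff)

lemma finite_words [simp]: "finite (words N n)"
  by (induction n) (simp_all add: words_Suc)

lemma sum_words_Suc:
  "(\<Sum>w\<in>words N (Suc n). f w) = (\<Sum>b=1..N. \<Sum>w\<in>words N n. f (b # w))"
proof -
  have "inj_on (\<lambda>(b, w). b # w) ({1..N} \<times> words N n)"
    by (auto simp: inj_on_def)
  then have "(\<Sum>w\<in>words N (Suc n). f w) = (\<Sum>(b, w)\<in>{1..N} \<times> words N n. f (b # w))"
    unfolding words_Suc by (subst sum.reindex) (auto simp: case_prod_unfold)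
  then show ?thesis
    by (simp add: sum.cartesian_product)
qed

lemma des_left_Nil [simp]: "des_left X [] = 0"
  and des_left_single [simp]: "des_left X [a] = 0"
  by (simp_all add: des_left_def)

text \<open>Position 0 compares \<open>a\<close> with \<open>b\<close>; every later position is a
  position of \<open>b # w\<close> shifted by one.\<close>

lemma des_left_Cons_Cons:
  "des_left X (a # b # w) = of_bool (a \<in> X \<and> b < a) + des_left X (b # w)"
proof -
  let ?D = "\<lambda>w. {i. Suc i < length w \<and> w ! i > w ! Suc i \<and> w ! i \<in> X}"
  have fin: "finite (?D (b # w))"
    by (rule finite_subset[of _ "{..<length (b # w)}"]) auto
  have "?D (a # b # w) = (if a \<in> X \<and> b < a then {0} else {}) \<union> Suc ` ?D (b # w)"
  proof (rule set_eqI)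
    fix i
    show "i \<in> ?D (a # b # w) \<longleftrightarrow>
        i \<in> (if a \<in> X \<and> b < a then {0} else {}) \<union> Suc ` ?D (b # w)"
      by (cases i) auto
  qed
  then show ?thesis
    using fin by (simp add: des_left_def card_image card_insert_if image_iff)
qed

text \<open>Complementing every letter, \<open>a\<close> to \<open>Suc N - a\<close>, is an
  involution on words that reverses all comparisons. It turns descents from letters of
  \<open>X\<close> into rises from letters of \<open>Y\<close>.\<close>

lemma card_ris_left_eq_card_des_left:
  assumes XY: "\<And>a. a \<in> {1..N} \<Longrightarrow> Suc N - a \<in> Y \<longleftrightarrow> a \<in> X"
  shows "card {w \<in> words N n. ris_left Y w = p} = card {w \<in> words N n. des_left X w = p}"
proof -
  define c where "c = map (\<lambda>a. Suc N - a)"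
  have c_words: "c w \<in> words N n" if "w \<in> words N n" for w
  proof -
    have "Suc N - a \<in> {1..N}" if "a \<in> {1..N}" for a
      using that by auto
    with that show ?thesis
      unfolding words_def c_def by (auto dest: subsetD simp del: atLeastAtMost_iff)
  qed
  have c_c: "c (c w) = w" if "w \<in> words N n" for w
    using that unfolding c_def words_def map_map by (intro map_idI) auto
  have ris_c: "ris_left Y (c w) = des_left X w" if w: "w \<in> words N n" for w
  proof -
    have letter: "w ! i \<in> {1..N}" if "i < length w" for i
      using w nth_mem[OF that] by (auto simp: words_def)
    have "Suc i < length (c w) \<and> c w ! i < c w ! Suc i \<and> c w ! i \<in> Y \<longleftrightarrow>
        Suc i < length w \<and> w ! i > w ! Suc i \<and> w ! i \<in> X" for i
    proof (cases "Suc i < length w")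
      case True
      then show ?thesis
        using letter[of i] letter[of "Suc i"] XY[of "w ! i"] by (auto simp: c_def)
    qed (simp add: c_def)
    then show ?thesis
      by (simp add: ris_left_def des_left_def)
  qed
  have des_c: "des_left X (c w) = ris_left Y w" if "w \<in> words N n" for w
    using ris_c[OF c_words[OF that]] c_c[OF that] by simp
  have "bij_betw c {w \<in> words N n. des_left X w = p} {w \<in> words N n. ris_left Y w = p}"
    by (rule bij_betw_byWitness[where f' = c]) (auto simp: c_words c_c ris_c des_c)
  then show ?thesis
    by (simp add: bij_betw_same_card)
qed

section \<open>The generating function of words by descents\<close>

definition word_fps :: "nat \<Rightarrow> nat set \<Rightarrow> 'a::comm_ring_1 \<Rightarrow> 'a fps" where
  "word_fps N X x = Abs_fps (\<lambda>n. \<Sum>w\<in>words N n. x ^ des_left X w)"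

definition word_fps_after :: "nat \<Rightarrow> nat set \<Rightarrow> 'a::comm_ring_1 \<Rightarrow> nat \<Rightarrow> 'a fps" where
  "word_fps_after N X x a = Abs_fps (\<lambda>n. \<Sum>w\<in>words N n. x ^ des_left X (a # w))"

text \<open>Unfolded, this sums \<open>z ^ m\<close> over all chains c_1 > ... > c_m > b in {1..a}
  with every c_i in \<open>X\<close>; only the last letter b is unrestricted.\<close>

primrec chain_sum :: "nat set \<Rightarrow> 'a::comm_ring_1 \<Rightarrow> nat \<Rightarrow> 'a" where
  "chain_sum X z 0 = 0"
| "chain_sum X z (Suc a) = chain_sum X z a * (1 + z * of_bool (Suc a \<in> X)) + 1"

lemma word_fps_eq: "word_fps N X x = 1 + fps_X * (\<Sum>b=1..N. word_fps_after N X x b)"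
proof (rule fps_ext)
  fix n
  show "word_fps N X x $ n = (1 + fps_X * (\<Sum>b=1..N. word_fps_after N X x b)) $ n"
    by (cases n) (simp_all add: word_fps_def word_fps_after_def sum_words_Suc fps_sum_nth)
qed

lemma word_fps_after_eq:
  assumes "a \<le> N"
  shows "word_fps_after N X x a = word_fps N X x +
    fps_const (x - 1) * fps_X * of_bool (a \<in> X) * (\<Sum>b=1..<a. word_fps_after N X x b)"
proof (rule fps_ext)
  fix n
  let ?G = "\<lambda>n b. \<Sum>w\<in>words N n. x ^ des_left X (b # w)"
  show "word_fps_after N X x a $ n = (word_fps N X x + fps_const (x - 1) * fps_X *
      of_bool (a \<in> X) * (\<Sum>b=1..<a. word_fps_after N X x b)) $ n"
  proof (cases n)
    case 0
    then show ?thesis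
      by (simp add: word_fps_def word_fps_after_def mult.assoc)
  next
    case (Suc m)
    have "?G (Suc m) a = (\<Sum>b=1..N. x ^ of_bool (a \<in> X \<and> b < a) * ?G m b)"
      by (simp add: sum_words_Suc des_left_Cons_Cons power_add sum_distrib_left)
    also have "\<dots> = (\<Sum>b=1..N. ?G m b + (x - 1) * of_bool (a \<in> X) * (of_bool (b < a) * ?G m b))"
      by (intro sum.cong) (auto simp: algebra_simps)
    also have "\<dots> = (\<Sum>b=1..N. ?G m b) +
        (x - 1) * of_bool (a \<in> X) * (\<Sum>b=1..N. of_bool (b < a) * ?G m b)"
      by (simp add: sum.distrib sum_distrib_left)
    \<comment> \<open>Since \<open>a \<le> N\<close>, every positive letter below \<open>a\<close>
      is in the alphabet.\<close>
    also have "(\<Sum>b=1..N. of_bool (b < a) * ?G m b) = (\<Sum>b=1..<a. ?G m b)"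
      using assms by (intro sum.mono_neutral_cong_right) auto
    finally show ?thesis
      using Suc by (simp add: word_fps_def word_fps_after_def sum_words_Suc fps_sum_nth mult.assoc)
  qed
qed

lemma sum_word_fps_after:
  assumes "a \<le> N"
  shows "(\<Sum>b=1..a. word_fps_after N X x b) =
    word_fps N X x * chain_sum X (fps_const (x - 1) * fps_X) a"
  using assms
proof (induction a)
  case (Suc a)
  have "(\<Sum>b=1..Suc a. word_fps_after N X x b) =
      (\<Sum>b=1..a. word_fps_after N X x b) + word_fps_after N X x (Suc a)"
    by simp
  also have "word_fps_after N X x (Suc a) = word_fps N X x +
      fps_const (x - 1) * fps_X * of_bool (Suc a \<in> X) * (\<Sum>b=1..a. word_fps_after N X x b)"
    using word_fps_after_eq[OF Suc.prems, of X x] by (simp only: atLeastLessThanSuc_atLeastAtMost)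
  finally show ?case
    using Suc by (simp add: algebra_simps)
qed simp

lemma fps_geometric_nth:
  fixes F A :: "'a::comm_ring_1 fps"
  assumes "F = 1 + fps_X * A * F"
  shows "F $ n = (\<Sum>j=0..n. A ^ j $ (n - j))"
proof -
  let ?S = "\<Sum>j<Suc n. (fps_X * A) ^ j"
  have "F * (1 - fps_X * A) = 1"
    using assms by (simp add: algebra_simps)
  moreover have "(1 - fps_X * A) * ?S = 1 - (fps_X * A) ^ Suc n"
    by (rule one_diff_power_eq[symmetric])
  ultimately have "?S = F * (1 - (fps_X * A) ^ Suc n)"
    by (metis mult.assoc mult_1)
  then have "F = ?S + fps_X ^ Suc n * (A ^ Suc n * F)"
    by (simp add: algebra_simps power_mult_distrib)
  then have "F $ n = ?S $ n + (fps_X ^ Suc n * (A ^ Suc n * F)) $ n"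
    by (metis fps_add_nth)
  also have "(fps_X ^ Suc n * (A ^ Suc n * F)) $ n = 0"
    by (subst fps_X_power_mult_nth) simp
  also have "?S $ n + 0 = (\<Sum>j=0..n. A ^ j $ (n - j))"
    unfolding fps_sum_nth power_mult_distrib fps_X_power_mult_nth add_0_right
    by (intro sum.cong) auto
  finally show ?thesis .
qed

lemma word_fps_nth:
  "word_fps N X x $ n =
    (\<Sum>j=0..n. chain_sum X (fps_const (x - 1) * fps_X) N ^ j $ (n - j))"
  by (rule fps_geometric_nth)
    (use word_fps_eq[of N X x] sum_word_fps_after[of N N X x] in \<open>simp add: mult_ac\<close>)

section \<open>Residue classes\<close>

lemma mem_residue_class_block:
  assumes "1 \<le> r" "r \<le> s" "1 \<le> i" "i \<le> s"
  shows "s * q + i \<in> residue_class s (int r) \<longleftrightarrow> i = r"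
proof -
  have "s * q + i \<in> residue_class s (int r) \<longleftrightarrow> [int i = int r] (mod int s)"
    by (simp add: residue_class_def cong_def)
  also have "\<dots> \<longleftrightarrow> int s dvd int i - int r"
    by (simp add: cong_iff_dvd_diff)
  also have "\<dots> \<longleftrightarrow> i = r"
  proof
    assume dvd: "int s dvd int i - int r"
    show "i = r"
    proof (rule ccontr)
      assume "i \<noteq> r"
      then have "int s \<le> \<bar>int i - int r\<bar>"
        using dvd dvd_imp_le_int[of "int i - int r" "int s"] by simp
      then show False
        using assms by linarith
    qed
  qed simp
  finally show ?thesis .
qed

text \<open>A block of s consecutive letters meets the residue class only in its r-th letter. There
  the recursion multiplies by 1 + z and adds 1; at every other letter it only adds 1.\<close>

lemma chain_sum_block:
  assumes "1 \<le> r" "r \<le> s" "i \<le> s"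
  shows "chain_sum (residue_class s (int r)) z (s * q + i) =
    (if i < r then chain_sum (residue_class s (int r)) z (s * q) + of_nat i
     else (chain_sum (residue_class s (int r)) z (s * q) + of_nat r - 1) * (1 + z)
       + 1 + of_nat i - of_nat r)"
  using assms(3)
proof (induction i)
  case 0
  then show ?case using assms by simp
next
  case (Suc i)
  have mem: "Suc (s * q + i) \<in> residue_class s (int r) \<longleftrightarrow> Suc i = r"
    using mem_residue_class_block[of r s "Suc i" q] assms Suc.prems by simp
  show ?case
    using Suc mem by (auto simp: algebra_simps)
qed

text \<open>A whole block acts as the affine map T \<mapsto> (1 + z) T + s + (r - 1) z, so iteration
  from 0 gives a geometric sum in 1 + z. The factor \<open>z\<close> on the left avoids dividing by
  (1 + z) - 1.\<close>

lemma chain_sum_residue_class: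
  assumes "1 \<le> r" "r \<le> s"
  shows "z * chain_sum (residue_class s (int r)) z (s * k) =
    ((1 + z) ^ k - 1) * (of_nat s + (of_nat r - 1) * z)"
proof (induction k)
  case (Suc k)
  have "chain_sum (residue_class s (int r)) z (s * Suc k) =
      (1 + z) * chain_sum (residue_class s (int r)) z (s * k) + ((of_nat r - 1) * z + of_nat s)"
    using chain_sum_block[OF assms order_refl, of z k] assms by (simp add: algebra_simps)
  then have "z * chain_sum (residue_class s (int r)) z (s * Suc k) =
      (1 + z) * (z * chain_sum (residue_class s (int r)) z (s * k)) +
      z * ((of_nat r - 1) * z + of_nat s)"
    by (simp only:) (simp add: algebra_simps)
  then show ?case
    unfolding Suc.IH by (simp add: algebra_simps)
qed simp

section \<open>Coefficients of powers of the closed form\<close>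

lemma fps_linear_power_nth:
  fixes y :: "'a::comm_ring_1"
  shows "(1 + fps_const y * fps_X) ^ m $ i = of_nat (m choose i) * y ^ i"
proof -
  have "(1 + fps_const y * fps_X) ^ m $ i =
      (\<Sum>l\<le>m. (of_nat (m choose l) * (fps_const (y ^ l) * fps_X ^ l)) $ i)"
    unfolding add.commute[of 1] binomial_ring
    by (simp add: power_mult_distrib fps_sum_nth mult.assoc)
  also have "\<dots> = (\<Sum>l\<le>m. if l = i then of_nat (m choose i) * y ^ i else 0)"
    by (intro sum.cong) (auto simp: fps_of_nat[symmetric])
  finally show ?thesis
    by (simp add: binomial_eq_0)
qed

text \<open>Both factors are expanded binomially, with \<open>i2\<close> indexing the powers of (1 +
  z)^k and \<open>i1\<close> those of d z. As \<open>fps_X\<close> occurs only inside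
  \<open>z\<close>, coefficient n carries exactly \<open>y ^ n\<close>.\<close>

lemma block_power_nth:
  fixes y :: "'a::comm_ring_1" and c d :: int
  assumes "j \<le> n"
  defines "z \<equiv> fps_const y * fps_X"
  shows "(((1 + z) ^ k - 1) * (of_int c + of_int d * z)) ^ j $ n =
    y ^ n * of_int (\<Sum>i1=0..j. \<Sum>i2=0..j. (-1) ^ (j + i2) * c ^ (j - i1) * d ^ i1
      * int (j choose i1) * int (j choose i2) * int ((k * i2) choose (n - i1)))"
proof -
  have 1: "((1 + z) ^ k - 1) ^ j =
      (\<Sum>i2=0..j. of_int ((-1) ^ (j + i2) * int (j choose i2)) * (1 + z) ^ (k * i2))"
  proof -
    have "((1 + z) ^ k + (-1)) ^ j =
        (\<Sum>i2\<le>j. of_nat (j choose i2) * ((1 + z) ^ k) ^ i2 * (-1) ^ (j - i2))"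
      by (rule binomial_ring)
    also have "\<dots> = (\<Sum>i2=0..j. of_int ((-1) ^ (j + i2) * int (j choose i2)) * (1 + z) ^ (k * i2))"
      unfolding atMost_atLeast0
    proof (intro sum.cong refl)
      fix i assume "i \<in> {0..j}"
      \<comment> \<open>For i \<le> j the two exponents have the same parity.\<close>
      then have "(-1 :: 'a fps) ^ (j - i) = (-1) ^ (j + i)"
        by (simp add: minus_one_power_iff)
      then show "of_nat (j choose i) * ((1 + z) ^ k) ^ i * (-1) ^ (j - i) =
          of_int ((-1) ^ (j + i) * int (j choose i)) * (1 + z) ^ (k * i)"
        unfolding power_mult[of "1 + z" k i]
        by (simp only: of_int_mult of_int_power of_int_minus of_int_1 of_int_of_nat_eq mult_ac)
    qed
    finally show ?thesis by simp
  qed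
  have 2: "(of_int c + of_int d * z) ^ j =
      (\<Sum>i1=0..j. of_int (c ^ (j - i1) * d ^ i1 * int (j choose i1)) * z ^ i1)"
    unfolding add.commute[of "of_int c"] binomial_ring
    by (simp add: power_mult_distrib atMost_atLeast0 mult_ac)
  have nth: "(z ^ i1 * (1 + z) ^ m) $ n = y ^ n * of_nat (m choose (n - i1))"
    if "i1 \<le> j" for i1 m
  proof -
    \<comment> \<open>This is where \<open>j \<le> n\<close> matters: \<open>n - i1\<close> is then
      a true difference, and \<open>z ^ i1\<close> shifts the index by \<open>i1\<close>.\<close>
    have "i1 \<le> n" using that assms by simp
    then show ?thesis
      by (simp add: z_def power_mult_distrib fps_X_power_mult_nth mult.assoc
          fps_linear_power_nth power_add[symmetric] mult.left_commute[of _ "of_nat _"])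
  qed
  have nth_of_int: "(of_int e * f) $ n = of_int e * (f $ n)" for e :: int and f :: "'a fps"
    by (simp add: fps_of_int[symmetric])
  have "(((1 + z) ^ k - 1) * (of_int c + of_int d * z)) ^ j =
      (\<Sum>i1=0..j. \<Sum>i2=0..j. of_int ((-1) ^ (j + i2) * c ^ (j - i1) * d ^ i1
      * int (j choose i1) * int (j choose i2)) * (z ^ i1 * (1 + z) ^ (k * i2)))"
    unfolding mult.commute[of "(1 + z) ^ k - 1"] power_mult_distrib 1 2 sum_product
    by (intro sum.cong refl) (simp only: of_int_mult mult_ac)
  then have "(((1 + z) ^ k - 1) * (of_int c + of_int d * z)) ^ j $ n =
      (\<Sum>i1=0..j. \<Sum>i2=0..j. of_int ((-1) ^ (j + i2) * c ^ (j - i1) * d ^ i1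
      * int (j choose i1) * int (j choose i2)) * (y ^ n * of_nat ((k * i2) choose (n - i1))))"
    by (simp only: fps_sum_nth nth_of_int) (simp add: nth)
  then show ?thesis
    by (simp add: sum_distrib_left mult_ac)
qed

text \<open>The closed form is known only for z times the chain sum. Multiplying the j-th power by
  z^j moves index n - j to n and adds a factor \<open>y ^ j\<close>, which is cancelled at the end;
  hence the integral domain and \<open>y \<noteq> 0\<close>.\<close>

lemma chain_sum_power_nth:
  fixes y :: "'a::idom"
  assumes "1 \<le> r" "r \<le> s" "j \<le> n" "y \<noteq> 0"
  shows "chain_sum (residue_class s (int r)) (fps_const y * fps_X) (s * k) ^ j $ (n - j) =
    y ^ (n - j) * of_int (\<Sum>i1=0..j. \<Sum>i2=0..j. (-1) ^ (j + i2) * int s ^ (j - i1)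
      * (int r - 1) ^ i1 * int (j choose i1) * int (j choose i2)
      * int ((k * i2) choose (n - i1)))" (is "?A ^ j $ _ = _ * of_int ?c")
proof -
  let ?z = "fps_const y * fps_X"
  have "y ^ j * (?A ^ j $ (n - j)) = (?z * ?A) ^ j $ n"
    using assms(3) by (simp add: power_mult_distrib fps_X_power_mult_nth mult.assoc)
  also have "?z * ?A = ((1 + ?z) ^ k - 1) * (of_int (int s) + of_int (int r - 1) * ?z)"
    using chain_sum_residue_class[OF assms(1,2), of ?z k] by simp
  also have "\<dots> ^ j $ n = y ^ n * of_int ?c"
    by (rule block_power_nth[OF assms(3)])
  also have "y ^ n = y ^ j * y ^ (n - j)"
    using assms(3) by (simp add: power_add[symmetric])
  finally show ?thesis
    using assms(4) by (simp add: mult.assoc)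
qed

section \<open>From the generating function to the number of words\<close>

lemma coeff_minus_one_linear_power:
  "coeff ([:-1, 1:] ^ m :: int poly) p = (-1) ^ (m + p) * int (m choose p)"
proof (cases "p \<le> m")
  case True
  then show ?thesis
    by (simp add: coeff_linear_poly_power minus_one_power_iff)
next
  case False
  then show ?thesis
    by (simp add: coeff_eq_0 degree_linear_power binomial_eq_0)
qed

text \<open>Taking the polynomial indeterminate for \<open>x\<close> makes each word a monomial
  whose degree is its number of descents.\<close>

lemma card_des_left_eq_coeff:
  "int (card {w \<in> words N n. des_left X w = p}) =
    coeff (word_fps N X ([:0, 1:] :: int poly) $ n) p"
proof -
  have "coeff ([:0, 1:] ^ d :: int poly) p = of_bool (d = p)" for d
    by (simp flip: monom_altdef[of 1, simplified] add: coeff_monom)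
  then show ?thesis
    by (simp add: word_fps_def coeff_sum Int_def)
qed

lemma card_des_left_residue_class:
  assumes "1 \<le> r" "r \<le> s"
  shows "int (card {w \<in> words (s * k) n. des_left (residue_class s (int r)) w = p}) =
      (\<Sum>j = 0..n. \<Sum>i1 = 0..j. \<Sum>i2 = 0..j.
         (-1) ^ (n + p + i2) * int s ^ (j - i1) * (int r - 1) ^ i1
         * int (j choose i1) * int (j choose i2)
         * int ((k * i2) choose (n - i1)) * int ((n - j) choose p))"
proof -
  let ?y = "[:-1, 1:] :: int poly"
  let ?c = "\<lambda>j. \<Sum>i1=0..j. \<Sum>i2=0..j. (-1) ^ (j + i2) * int s ^ (j - i1)
      * (int r - 1) ^ i1 * int (j choose i1) * int (j choose i2)
      * int ((k * i2) choose (n - i1))"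
  \<comment> \<open>This is x - 1 for the indeterminate x, a nonzero polynomial, as the cancellation
    requires.\<close>
  have y: "[:0, 1:] - 1 = ?y"
    by (simp add: one_pCons)
  have "word_fps (s * k) (residue_class s (int r)) ([:0, 1:] :: int poly) $ n =
      (\<Sum>j=0..n. ?y ^ (n - j) * of_int (?c j))"
    unfolding word_fps_nth y
    by (intro sum.cong refl chain_sum_power_nth assms) auto
  then have "int (card {w \<in> words (s * k) n. des_left (residue_class s (int r)) w = p}) =
      (\<Sum>j=0..n. coeff (?y ^ (n - j) * of_int (?c j)) p)"
    by (simp only: card_des_left_eq_coeff coeff_sum)
  also have "\<dots> = (\<Sum>j=0..n. (-1) ^ (n - j + p) * int ((n - j) choose p) * ?c j)"
    \<comment> \<open>The inner double sum is a constant polynomial, so it merely scales the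
      coefficients of (x - 1)^(n - j).\<close>
    by (simp only: of_int_poly mult.commute[of _ "[:_:]"] coeff_minus_one_linear_power)
      (simp add: coeff_minus_one_linear_power mult_ac)
  also have "\<dots> = (\<Sum>j = 0..n. \<Sum>i1 = 0..j. \<Sum>i2 = 0..j.
         (-1) ^ (n + p + i2) * int s ^ (j - i1) * (int r - 1) ^ i1
         * int (j choose i1) * int (j choose i2)
         * int ((k * i2) choose (n - i1)) * int ((n - j) choose p))"
    unfolding sum_distrib_left
  proof (intro sum.cong refl)
    fix j i1 i2 assume "j \<in> {0..n}"
    then have "(-1 :: int) ^ (n + p + i2) = (-1) ^ (n - j + p) * (-1) ^ (j + i2)"
      by (simp add: power_add[symmetric] add.assoc)
    then show "(-1) ^ (n - j + p) * int ((n - j) choose p) * ((-1) ^ (j + i2) * int s ^ (j - i1)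
        * (int r - 1) ^ i1 * int (j choose i1) * int (j choose i2)
        * int ((k * i2) choose (n - i1))) =
        (-1) ^ (n + p + i2) * int s ^ (j - i1) * (int r - 1) ^ i1
         * int (j choose i1) * int (j choose i2)
         * int ((k * i2) choose (n - i1)) * int ((n - j) choose p)"
      by (simp only: mult_ac)
  qed
  finally show ?thesis .
qed

text \<open>The two differences to be tested for divisibility by s add up to s (k - 1), so s divides
  both or neither.\<close>

lemma complement_mem_residue_class:
  assumes "a \<le> s * k"
  shows "Suc (s * k) - a \<in> residue_class s (int s + 1 - int r) \<longleftrightarrow>
    a \<in> residue_class s (int r)"
proof -
  have "int (Suc (s * k) - a) - (int s + 1 - int r) = int s * (int k - 1) - (int a - int r)"
    using assms by (simp add: of_nat_diff algebra_simps)
  then show ?thesis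
    unfolding residue_class_def mem_Collect_eq cong_iff_dvd_diff
    by (metis dvd_triv_left dvd_diff_right_iff)
qed

theorem theorem5p1:
  fixes s k r n p :: nat
  assumes "s \<ge> 2" and "k \<ge> 1" and "1 \<le> r" and "r \<le> s"
  shows "int (card {w \<in> words (s * k) n. des_left (residue_class s (int r)) w = p}) =
      (\<Sum>j = 0..n. \<Sum>i1 = 0..j. \<Sum>i2 = 0..j.
         (-1) ^ (n + p + i2) * int s ^ (j - i1) * (int r - 1) ^ i1
         * int (j choose i1) * int (j choose i2)
         * int ((k * i2) choose (n - i1)) * int ((n - j) choose p))
    \<and> card {w \<in> words (s * k) n. ris_left (residue_class s (int s + 1 - int r)) w = p} =
      card {w \<in> words (s * k) n. des_left (residue_class s (int r)) w = p}"
  using card_des_left_residue_class[OF assms(3,4)]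
    card_ris_left_eq_card_des_left[OF complement_mem_residue_class] by simp

end
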